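(* Let $d\in\mathbb{N}$, let $c>0$, and let $\mathscr{L}=L^2(\mathbb{R}^d)\cap L^\infty(\mathbb{R}^d)$ (complex-valued functions, Lebesgue measure). Consider the Fock representation, with unit vector $\Phi$, of the square of white noise algebra over $\mathscr{L}$ with constant $c$. Then for every $f\in\mathscr{L}$ with $\|f\|_\infty<\frac12$ the exponential vector $$\psi(f)=\sum_{m=0}^\infty\frac{(B_f^* )^m\Phi}{m!}$$ exists (i.e. the series converges), and for all $f,g\in\mathscr{L}$ with $\|f\|_\infty<\frac12$ and $\|g\|_\infty<\frac12$ one has $$\langle\psi(f),\psi(g)\rangle=\exp\Bigl(-\frac{c}{2}\int_{\mathbb{R}^d}\ln\bigl(1-4\,\overline{f(t)}\,g(t)\bigr)\,dt\Bigr).$$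
   Context: Inner products are linear in the second and conjugate-linear in the first argument; $\langle f,g\rangle=\int_{\mathbb{R}^d}\overline{f(t)}g(t)\,dt$; products of functions are pointwise; $\ln$ is the principal branch of the logarithm. Square of white noise (SWN) algebra: for $\mathscr{L}=L^2(\mathbb{R}^d)\cap L^\infty(\mathbb{R}^d)$ and a constant $c>0$, the SWN algebra $\mathcal{A}$ over $\mathscr{L}$ is the unital $*$-algebra generated by symbols $B_f,N_f$ ($f\in\mathscr{L}$) subject to the commutation relations $$[B_f,B_g^*]=2c\langle f,g\rangle+4N_{\overline{f}g},\qquad [N_f,B_g^*]=2B_{fg}^*\qquad(f,g\in\mathscr{L}),$$ with all other commutators (apart from those obtained from these by taking adjoints) equal to $0$, i.e. $[B_f,B_g]=[B_f^*,B_g^*]=[N_f,N_g]=0$. One has $N_f^*=N_{\overline{f}}$. Fock representation: a $*$-representation $\pi$ of $\mathcal{A}$ (by adjointable operators) on a pre-Hilbert space $H$ with a unit vector $\Phi\in H$ such that $\pi(\mathcal{A})\Phi=H$ and $\pi(B_f)\Phi=\pi(N_f)\Phi=0$ for all $f\in\mathscr{L}$. A Fock representation is known to exist and is unique up to unitary equivalence, so one speaks of the Fock representation; one writes $B_f,N_f$ for $\pi(B_f),\pi(N_f)$. Exponential vector: for $f\in\mathscr{L}$, $\psi(f):=\sum_{m=0}^\infty\frac{(B_f^* )^m\Phi}{m!}$ whenever this series converges (in norm, in the Hilbert space completion of $H$). *)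

theory Defs
  imports "HOL-Probability.Essential_Supremum"
begin

section \<open>Complex Hilbert spaces\<close>

text \<open>
  Built on top of \<^class>\<open>real_inner\<close>, so that norm, limits and series are those of the library.
  The complex inner product is linear in the second argument; its real part is the real one,
  hence \<open>norm x = sqrt (Re (cinner x x))\<close>.
\<close>

class complex_inner = real_inner +
  fixes scaleC :: "complex \<Rightarrow> 'a \<Rightarrow> 'a"  (infixr "*\<^sub>C" 75)
    and cinner :: "'a \<Rightarrow> 'a \<Rightarrow> complex"
  assumes scaleC_add_right: "a *\<^sub>C (x + y) = a *\<^sub>C x + a *\<^sub>C y"
    and scaleC_add_left: "(a + b) *\<^sub>C x = a *\<^sub>C x + b *\<^sub>C x"
    and scaleC_scaleC: "a *\<^sub>C (b *\<^sub>C x) = (a * b) *\<^sub>C x"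
    and scaleC_of_real: "complex_of_real r *\<^sub>C x = scaleR r x"
    and cinner_commute: "cinner x y = cnj (cinner y x)"
    and cinner_add_right: "cinner x (y + z) = cinner x y + cinner x z"
    and cinner_scaleC_right: "cinner x (a *\<^sub>C y) = a * cinner x y"
    and Re_cinner: "Re (cinner x y) = inner x y"

class complex_hilbert = complex_inner + complete_space

instantiation complex :: complex_hilbert
begin
definition scaleC_complex :: "complex \<Rightarrow> complex \<Rightarrow> complex" where "scaleC_complex a x = a * x"
definition cinner_complex :: "complex \<Rightarrow> complex \<Rightarrow> complex" where "cinner_complex x y = cnj x * y"
instance
  by standard
    (auto simp: scaleC_complex_def cinner_complex_def algebra_simps scaleR_conv_of_real inner_complex_def)
end

definition csubspace :: "'a::complex_inner set \<Rightarrow> bool" where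
  "csubspace H \<longleftrightarrow> 0 \<in> H \<and> (\<forall>x\<in>H. \<forall>y\<in>H. x + y \<in> H) \<and> (\<forall>a. \<forall>x\<in>H. a *\<^sub>C x \<in> H)"


section \<open>The space of test functions\<close>

text \<open>
  Elements of the type are functions, not classes modulo null sets; almost everywhere equal
  functions are identified in the relations of the algebra below.
\<close>

typedef (overloaded) 'd L2Linf =
  "{f :: real ^ 'd::finite \<Rightarrow> complex. f \<in> borel_measurable lebesgue
      \<and> integrable lebesgue (\<lambda>t. (norm (f t))\<^sup>2)
      \<and> esssup lebesgue (\<lambda>t. ereal (norm (f t))) < \<infinity>}"
  morphisms fun_of Abs_L2Linf
proof (rule exI[of _ "\<lambda>_. 0"], safe)
  have "esssup lebesgue (\<lambda>t::real^'d. ereal (norm (0::complex))) \<le> 0"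
    by (rule esssup_I) auto
  then show "esssup lebesgue (\<lambda>t::real^'d. ereal (norm (0::complex))) < \<infinity>"
    by (rule le_less_trans) simp
qed auto

setup_lifting type_definition_L2Linf

definition Linf_norm :: "'d::finite L2Linf \<Rightarrow> ereal" where
  "Linf_norm f = esssup lebesgue (\<lambda>t. ereal (norm (fun_of f t)))"

definition L2_inner :: "'d::finite L2Linf \<Rightarrow> 'd L2Linf \<Rightarrow> complex" where
  "L2_inner f g = (LINT t|lebesgue. cnj (fun_of f t) * fun_of g t)"

lift_definition conj_fun :: "'d::finite L2Linf \<Rightarrow> 'd L2Linf" is "\<lambda>f t. cnj (f t)"
proof safe
  fix f :: "real ^ 'd \<Rightarrow> complex"
  assume [measurable]: "f \<in> borel_measurable lebesgue"
  have "continuous_on UNIV cnj" by (intro continuous_intros)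
  then have [measurable]: "cnj \<in> borel_measurable borel" by (rule borel_measurable_continuous_onI)
  show "(\<lambda>t. cnj (f t)) \<in> borel_measurable lebesgue" by measurable
qed auto

lemma bounded_AE_of_esssup:
  fixes h :: "real ^ 'd::finite \<Rightarrow> complex"
  assumes "esssup lebesgue (\<lambda>t. ereal (norm (h t))) < \<infinity>"
  obtains C where "AE t in lebesgue. norm (h t) \<le> C"
proof -
  obtain C where C: "esssup lebesgue (\<lambda>t. ereal (norm (h t))) \<le> ereal C"
    using assms by (cases "esssup lebesgue (\<lambda>t. ereal (norm (h t)))") auto
  have "AE t in lebesgue. norm (h t) \<le> C"
    using esssup_AE[of "\<lambda>t. ereal (norm (h t))" lebesgue]
  proof (rule eventually_mono)
    fix t assume "ereal (norm (h t)) \<le> esssup lebesgue (\<lambda>t. ereal (norm (h t)))"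
    then have "ereal (norm (h t)) \<le> ereal C" using C by (rule order_trans)
    then show "norm (h t) \<le> C" by simp
  qed
  then show thesis by (rule that)
qed

lift_definition mult_fun :: "'d::finite L2Linf \<Rightarrow> 'd L2Linf \<Rightarrow> 'd L2Linf" is "\<lambda>f g t. f t * g t"
proof (intro CollectI conjI; elim CollectE conjE)
  fix f g :: "real ^ 'd \<Rightarrow> complex"
  assume [measurable]: "f \<in> borel_measurable lebesgue" "g \<in> borel_measurable lebesgue"
    and f: "esssup lebesgue (\<lambda>t. ereal (norm (f t))) < \<infinity>"
    and g: "esssup lebesgue (\<lambda>t. ereal (norm (g t))) < \<infinity>"
    and g2: "integrable lebesgue (\<lambda>t. (norm (g t))\<^sup>2)"
  show "(\<lambda>t. f t * g t) \<in> borel_measurable lebesgue" by measurable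
  obtain C where C: "AE t in lebesgue. norm (f t) \<le> C" by (rule bounded_AE_of_esssup[OF f])
  obtain D where D: "AE t in lebesgue. norm (g t) \<le> D" by (rule bounded_AE_of_esssup[OF g])
  show "integrable lebesgue (\<lambda>t. (norm (f t * g t))\<^sup>2)"
  proof (rule Bochner_Integration.integrable_bound)
    show "integrable lebesgue (\<lambda>t. C\<^sup>2 * (norm (g t))\<^sup>2)" using g2 by simp
    show "AE t in lebesgue. norm ((norm (f t * g t))\<^sup>2) \<le> norm (C\<^sup>2 * (norm (g t))\<^sup>2)"
      using C
    proof (rule eventually_mono)
      fix t assume "norm (f t) \<le> C"
      then have "(norm (f t))\<^sup>2 \<le> C\<^sup>2" by (intro power_mono) auto
      then show "norm ((norm (f t * g t))\<^sup>2) \<le> norm (C\<^sup>2 * (norm (g t))\<^sup>2)"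
        by (simp add: norm_mult power_mult_distrib mult_right_mono)
    qed
  qed measurable
  have "esssup lebesgue (\<lambda>t. ereal (norm (f t * g t))) \<le> ereal (C * D)"
  proof (rule esssup_I)
    show "AE t in lebesgue. ereal (norm (f t * g t)) \<le> ereal (C * D)"
      using C D
    proof eventually_elim
      case (elim t)
      have "0 \<le> C" using norm_ge_zero elim(1) by (rule order_trans)
      then have "norm (f t) * norm (g t) \<le> C * D"
        using elim by (intro mult_mono) auto
      then show ?case by (simp add: norm_mult)
    qed
  qed measurable
  then show "esssup lebesgue (\<lambda>t. ereal (norm (f t * g t))) < \<infinity>" by (rule le_less_trans) simp
qed


section \<open>The square of white noise algebra\<close>

text \<open>
  The unital \<open>*\<close>-algebra presented by the symbols \<open>B\<^sub>f\<close>, \<open>N\<^sub>f\<close> and the relations: formal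
  expressions modulo the least congruence containing the axioms of complex unital
  \<open>*\<close>-algebras and the given relations.
\<close>

datatype 'd swn_term =
    SymB "'d L2Linf"
  | SymN "'d L2Linf"
  | Zero
  | One
  | Add "'d swn_term" "'d swn_term"  (infixl "\<oplus>" 65)
  | Mult "'d swn_term" "'d swn_term"  (infixl "\<odot>" 70)
  | Scale complex "'d swn_term"  (infixr "\<cdot>\<^sub>C" 75)
  | Star "'d swn_term"  ("_\<^sup>\<star>" [1000] 999)

definition commutator :: "'d::finite swn_term \<Rightarrow> 'd swn_term \<Rightarrow> 'd swn_term" where
  "commutator x y = x \<odot> y \<oplus> (-1) \<cdot>\<^sub>C (y \<odot> x)"

inductive swn_eq :: "real \<Rightarrow> 'd::finite swn_term \<Rightarrow> 'd swn_term \<Rightarrow> bool" for c :: real where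
  \<comment> \<open>congruence\<close>
  refl: "swn_eq c x x"
| sym: "swn_eq c x y \<Longrightarrow> swn_eq c y x"
| trans: "swn_eq c x y \<Longrightarrow> swn_eq c y z \<Longrightarrow> swn_eq c x z"
| add_cong: "swn_eq c x x' \<Longrightarrow> swn_eq c y y' \<Longrightarrow> swn_eq c (x \<oplus> y) (x' \<oplus> y')"
| mult_cong: "swn_eq c x x' \<Longrightarrow> swn_eq c y y' \<Longrightarrow> swn_eq c (x \<odot> y) (x' \<odot> y')"
| scale_cong: "swn_eq c x x' \<Longrightarrow> swn_eq c (a \<cdot>\<^sub>C x) (a \<cdot>\<^sub>C x')"
| star_cong: "swn_eq c x x' \<Longrightarrow> swn_eq c (x\<^sup>\<star>) (x'\<^sup>\<star>)"
  \<comment> \<open>complex vector space\<close>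
| add_assoc: "swn_eq c ((x \<oplus> y) \<oplus> z) (x \<oplus> (y \<oplus> z))"
| add_commute: "swn_eq c (x \<oplus> y) (y \<oplus> x)"
| add_zero: "swn_eq c (x \<oplus> Zero) x"
| add_neg: "swn_eq c (x \<oplus> (-1) \<cdot>\<^sub>C x) Zero"
| scale_add_right: "swn_eq c (a \<cdot>\<^sub>C (x \<oplus> y)) (a \<cdot>\<^sub>C x \<oplus> a \<cdot>\<^sub>C y)"
| scale_add_left: "swn_eq c ((a + b) \<cdot>\<^sub>C x) (a \<cdot>\<^sub>C x \<oplus> b \<cdot>\<^sub>C x)"
| scale_scale: "swn_eq c (a \<cdot>\<^sub>C b \<cdot>\<^sub>C x) ((a * b) \<cdot>\<^sub>C x)"
| scale_one: "swn_eq c (1 \<cdot>\<^sub>C x) x"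
  \<comment> \<open>associative unital algebra\<close>
| mult_assoc: "swn_eq c ((x \<odot> y) \<odot> z) (x \<odot> (y \<odot> z))"
| mult_one_left: "swn_eq c (One \<odot> x) x"
| mult_one_right: "swn_eq c (x \<odot> One) x"
| distrib_left: "swn_eq c (x \<odot> (y \<oplus> z)) (x \<odot> y \<oplus> x \<odot> z)"
| distrib_right: "swn_eq c ((x \<oplus> y) \<odot> z) (x \<odot> z \<oplus> y \<odot> z)"
| scale_mult_left: "swn_eq c ((a \<cdot>\<^sub>C x) \<odot> y) (a \<cdot>\<^sub>C (x \<odot> y))"
| scale_mult_right: "swn_eq c (x \<odot> (a \<cdot>\<^sub>C y)) (a \<cdot>\<^sub>C (x \<odot> y))"
  \<comment> \<open>involution\<close>
| star_star: "swn_eq c ((x\<^sup>\<star>)\<^sup>\<star>) x"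
| star_add: "swn_eq c ((x \<oplus> y)\<^sup>\<star>) (x\<^sup>\<star> \<oplus> y\<^sup>\<star>)"
| star_scale: "swn_eq c ((a \<cdot>\<^sub>C x)\<^sup>\<star>) (cnj a \<cdot>\<^sub>C x\<^sup>\<star>)"
| star_mult: "swn_eq c ((x \<odot> y)\<^sup>\<star>) (y\<^sup>\<star> \<odot> x\<^sup>\<star>)"
  \<comment> \<open>symbols depend only on the class of the function modulo null sets\<close>
| B_AE: "AE t in lebesgue. fun_of f t = fun_of g t \<Longrightarrow> swn_eq c (SymB f) (SymB g)"
| N_AE: "AE t in lebesgue. fun_of f t = fun_of g t \<Longrightarrow> swn_eq c (SymN f) (SymN g)"
  \<comment> \<open>square of white noise relations\<close>
| comm_B_Bstar: "swn_eq c (commutator (SymB f) ((SymB g)\<^sup>\<star>))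
    ((2 * complex_of_real c * L2_inner f g) \<cdot>\<^sub>C One \<oplus> 4 \<cdot>\<^sub>C SymN (mult_fun (conj_fun f) g))"
| comm_N_Bstar: "swn_eq c (commutator (SymN f) ((SymB g)\<^sup>\<star>)) (2 \<cdot>\<^sub>C (SymB (mult_fun f g))\<^sup>\<star>)"
| comm_B_B: "swn_eq c (commutator (SymB f) (SymB g)) Zero"
| comm_Bstar_Bstar: "swn_eq c (commutator ((SymB f)\<^sup>\<star>) ((SymB g)\<^sup>\<star>)) Zero"
| comm_N_N: "swn_eq c (commutator (SymN f) (SymN g)) Zero"
| star_N: "swn_eq c ((SymN f)\<^sup>\<star>) (SymN (conj_fun f))"

definition swn_rel :: "real \<Rightarrow> ('d::finite swn_term \<times> 'd swn_term) set" where
  "swn_rel c = {(x, y). swn_eq c x y}"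

lemma equiv_swn_rel: "equiv UNIV (swn_rel c)"
  unfolding swn_rel_def
  by (auto intro!: equivI refl_onI symI transI intro: swn_eq.refl swn_eq.sym swn_eq.trans)

definition swn_algebra :: "real \<Rightarrow> 'd::finite swn_term set set" where
  "swn_algebra c = UNIV // swn_rel c"

definition swn_class :: "real \<Rightarrow> 'd::finite swn_term \<Rightarrow> 'd swn_term set" where
  "swn_class c x = swn_rel c `` {x}"


section \<open>Fock representation and exponential vectors\<close>

text \<open>
  The pre-Hilbert space \<open>H\<close> is given as a dense subspace of its completion, the type \<open>'k\<close>; only
  the values of the operators \<open>\<pi> a\<close> on \<open>H\<close> are meaningful. The operations of the algebra are
  the operations of \<^typ>\<open>'d swn_term\<close> on representatives.
\<close>

locale swn_star_representation =
  fixes c :: real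
    and H :: "'k::complex_hilbert set"
    and \<pi> :: "'d::finite swn_term set \<Rightarrow> 'k \<Rightarrow> 'k"
  assumes subspace: "csubspace H"
    and dense: "closure H = UNIV"
    and maps_to: "a \<in> swn_algebra c \<Longrightarrow> x \<in> H \<Longrightarrow> \<pi> a x \<in> H"
    and op_add: "a \<in> swn_algebra c \<Longrightarrow> x \<in> H \<Longrightarrow> y \<in> H \<Longrightarrow> \<pi> a (x + y) = \<pi> a x + \<pi> a y"
    and op_scale: "a \<in> swn_algebra c \<Longrightarrow> x \<in> H \<Longrightarrow> \<pi> a (z *\<^sub>C x) = z *\<^sub>C \<pi> a x"
    and rep_add: "x \<in> H \<Longrightarrow> \<pi> (swn_class c (s \<oplus> t)) x = \<pi> (swn_class c s) x + \<pi> (swn_class c t) x"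
    and rep_scale: "x \<in> H \<Longrightarrow> \<pi> (swn_class c (z \<cdot>\<^sub>C s)) x = z *\<^sub>C \<pi> (swn_class c s) x"
    and rep_one: "x \<in> H \<Longrightarrow> \<pi> (swn_class c One) x = x"
    and rep_mult: "x \<in> H \<Longrightarrow> \<pi> (swn_class c (s \<odot> t)) x = \<pi> (swn_class c s) (\<pi> (swn_class c t) x)"
    and rep_star: "x \<in> H \<Longrightarrow> y \<in> H \<Longrightarrow>
      cinner (\<pi> (swn_class c (s\<^sup>\<star>)) x) y = cinner x (\<pi> (swn_class c s) y)"

locale fock_representation = swn_star_representation c H \<pi>
  for c :: real and H :: "'k::complex_hilbert set"
    and \<pi> :: "'d::finite swn_term set \<Rightarrow> 'k \<Rightarrow> 'k" +
  fixes \<Phi> :: 'k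
  assumes vacuum_in: "\<Phi> \<in> H"
    and vacuum_unit: "norm \<Phi> = 1"
    and cyclic: "(\<lambda>a. \<pi> a \<Phi>) ` swn_algebra c = H"
    and B_vacuum: "\<pi> (swn_class c (SymB f)) \<Phi> = 0"
    and N_vacuum: "\<pi> (swn_class c (SymN f)) \<Phi> = 0"

definition exp_vector_term ::
    "real \<Rightarrow> ('d::finite swn_term set \<Rightarrow> 'k::complex_hilbert \<Rightarrow> 'k) \<Rightarrow> 'k \<Rightarrow> 'd L2Linf \<Rightarrow> nat \<Rightarrow> 'k" where
  "exp_vector_term c \<pi> \<Phi> f m = ((\<pi> (swn_class c ((SymB f)\<^sup>\<star>)) ^^ m) \<Phi>) /\<^sub>R fact m"

definition exp_vector ::
    "real \<Rightarrow> ('d::finite swn_term set \<Rightarrow> 'k::complex_hilbert \<Rightarrow> 'k) \<Rightarrow> 'k \<Rightarrow> 'd L2Linf \<Rightarrow> 'k" where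
  "exp_vector c \<pi> \<Phi> f = (\<Sum>m. exp_vector_term c \<pi> \<Phi> f m)"

end

(* Write P_f(m) for (B_f^* )^m Phi. The commutation relations give
     B_u P_g(n) = 2 c n <u,g> P_g(n-1) + 4 n (n-1) B^*_{conj(u) g^2} P_g(n-2).
   Applying this alternately to the left and the right argument of <P_f(m), B_u^* P_g(n)> never
   leaves that class of inner products and expresses each of them by the Gram matrix of the
   vectors P_f(m)/m! and P_g(n)/n! and the moments of h = 4 conj(f) g. Hence this Gram matrix is
   diagonal, and its diagonal entries e_n satisfy
     (n+1) e_{n+1} = sum_{j<=n} (c/2) (integral of h^(j+1)) e_{n-j},
   which is the recurrence for the coefficients of exp (sum_{k>=1} (c/2) (integral of h^k) z^k/k).
   As |h| <= q < 1 almost everywhere, the radius of convergence exceeds 1, and z = 1 gives the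
   formula. For f = g the same fact makes the squared norms decay geometrically, so the series
   for psi(f) converges absolutely. *)

theory Submission
  imports Defs "HOL-Complex_Analysis.Laurent_Convergence"
begin

section \<open>Complex inner product spaces\<close>

lemma scaleC_zero_left: "0 *\<^sub>C (x::'a::complex_inner) = 0"
  using scaleC_of_real[of 0 x] by simp

lemma cinner_add_left: "cinner (x + y) z = cinner x z + cinner y (z::'a::complex_inner)"
  by (metis cinner_commute cinner_add_right complex_cnj_add)

lemma cinner_scaleC_left: "cinner (a *\<^sub>C x) y = cnj a * cinner x (y::'a::complex_inner)"
  by (metis cinner_commute cinner_scaleC_right complex_cnj_mult)

lemma cinner_zero_left: "cinner 0 (x::'a::complex_inner) = 0"
  using cinner_add_left[of 0 0 x] by simp

lemma cinner_zero_right: "cinner (x::'a::complex_inner) 0 = 0"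
  using cinner_add_right[of x 0 0] by simp

lemma cinner_scaleR_right: "cinner x (r *\<^sub>R y) = of_real r * cinner x (y::'a::complex_inner)"
  using cinner_scaleC_right[of x "of_real r" y] by (simp add: scaleC_of_real)

lemma cinner_scaleR_left: "cinner (r *\<^sub>R x) y = of_real r * cinner x (y::'a::complex_inner)"
  using cinner_scaleC_left[of "of_real r" x y] by (simp add: scaleC_of_real)

text \<open>By conjugate-linearity a factor i on the left comes out as -i, which turns the imaginary
  part into a real part. Limits thereby reduce to the real inner product.\<close>

lemma cinner_eq_Complex_inner:
  "cinner x (y::'a::complex_inner) = Complex (inner x y) (inner (\<i> *\<^sub>C x) y)"
  by (rule complex_eqI) (simp_all flip: Re_cinner add: cinner_scaleC_left)

lemma cinner_sums_right:
  fixes x :: "'a::complex_inner"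
  assumes "u sums s"
  shows "(\<lambda>n. cinner x (u n)) sums cinner x s"
  unfolding cinner_eq_Complex_inner sums_complex_iff complex.sel
  using assms by (auto intro: bounded_linear.sums[OF bounded_linear_inner_right])

lemma cinner_self_eq_norm: "cinner x x = complex_of_real ((norm (x::'a::complex_inner))\<^sup>2)"
proof (rule complex_eqI)
  show "Re (cinner x x) = Re (complex_of_real ((norm x)\<^sup>2))"
    by (simp add: Re_cinner power2_norm_eq_inner)
  show "Im (cinner x x) = Im (complex_of_real ((norm x)\<^sup>2))"
    using cinner_commute[of x x] by (simp add: complex_eq_iff)
qed

instance complex_hilbert \<subseteq> banach ..

text \<open>Only one side is expanded at a time: against a fixed \<open>u m\<close>, the series for
  \<open>y\<close> keeps the single term \<open>v m\<close>. No double series arises.\<close>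

lemma cinner_sums_orthogonal:
  fixes u v :: "nat \<Rightarrow> 'a::complex_inner"
  assumes u: "u sums x" and v: "v sums y"
    and orth: "\<And>m n. m \<noteq> n \<Longrightarrow> cinner (u m) (v n) = 0"
  shows "(\<lambda>n. cinner (u n) (v n)) sums cinner x y"
proof -
  have um: "cinner (u m) y = cinner (u m) (v m)" for m
  proof -
    have "(\<lambda>n. cinner (u m) (v n)) sums cinner (u m) (v m)"
      using sums_finite[of "{m}" "\<lambda>n. cinner (u m) (v n)"] orth by auto
    then show ?thesis
      using cinner_sums_right[OF v] sums_unique2 by blast
  qed
  have "(\<lambda>m. cnj (cinner y (u m))) sums cnj (cinner y x)"
    using cinner_sums_right[OF u] by (simp add: sums_cnj)
  then show ?thesis
    by (simp add: um flip: cinner_commute)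
qed


section \<open>Test functions\<close>

lemma L2_inner_commute: "L2_inner f g = cnj (L2_inner g f)"
  unfolding L2_inner_def by (subst Bochner_Integration.integral_cnj[symmetric]) (simp add: mult.commute)

lemma integrable_cnj_mult_L2Linf: "integrable lebesgue (\<lambda>t. cnj (fun_of f t) * fun_of g t)"
proof -
  have f: "fun_of f \<in> borel_measurable lebesgue" "integrable lebesgue (\<lambda>t. (norm (fun_of f t))\<^sup>2)"
    and g[measurable]: "fun_of g \<in> borel_measurable lebesgue"
      "integrable lebesgue (\<lambda>t. (norm (fun_of g t))\<^sup>2)"
    using fun_of[of f] fun_of[of g] by auto
  have "fun_of (conj_fun f) \<in> borel_measurable lebesgue"
    using fun_of[of "conj_fun f"] by auto
  then have [measurable]: "(\<lambda>t. cnj (fun_of f t)) \<in> borel_measurable lebesgue"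
    by (simp add: conj_fun.rep_eq)
  show ?thesis
  proof (rule Bochner_Integration.integrable_bound)
    show "integrable lebesgue (\<lambda>t. (norm (fun_of f t))\<^sup>2 + (norm (fun_of g t))\<^sup>2)"
      using f g by auto
    have "norm (fun_of f t) * norm (fun_of g t)
        \<le> (norm (fun_of f t))\<^sup>2 + (norm (fun_of g t))\<^sup>2" for t
      using sum_squares_bound[of "norm (fun_of f t)" "norm (fun_of g t)"]
        mult_nonneg_nonneg[OF norm_ge_zero[of "fun_of f t"] norm_ge_zero[of "fun_of g t"]]
      by linarith
    then show "AE t in lebesgue. norm (cnj (fun_of f t) * fun_of g t)
        \<le> norm ((norm (fun_of f t))\<^sup>2 + (norm (fun_of g t))\<^sup>2)"
      by (simp add: norm_mult)
  qed measurable
qed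

lemma Linf_norm_less_imp_AE_bound:
  assumes "Linf_norm f < ereal r" "0 < r"
  obtains a where "0 < a" "a < r" "AE t in lebesgue. norm (fun_of f t) \<le> a"
proof -
  obtain b where b: "Linf_norm f < ereal b" "ereal b < ereal r"
    using ereal_dense2[OF assms(1)] by auto
  have "AE t in lebesgue. ereal (norm (fun_of f t)) \<le> Linf_norm f"
    unfolding Linf_norm_def by (rule esssup_AE)
  \<comment> \<open>The maximum with \<open>r/2\<close> secures a positive bound without discussing
    the sign of the essential supremum.\<close>
  then have "AE t in lebesgue. norm (fun_of f t) \<le> max b (r/2)"
  proof eventually_elim
    case (elim t)
    then have "ereal (norm (fun_of f t)) \<le> ereal b" using b(1) by order
    then show ?case by simp
  qed
  then show thesis
    using that[of "max b (r/2)"] b assms(2) by auto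
qed


section \<open>Exponentials of power series\<close>

text \<open>The equation \<open>Y' = Y * P'\<close> determines coefficient k+1 from those up to k,
  so its solution with constant term 1 is unique; the composed exponential is one.\<close>

lemma fps_exp_compose_eqI:
  fixes E P :: "complex fps"
  assumes P0: "fps_nth P 0 = 0" and E0: "fps_nth E 0 = 1" and ode: "fps_deriv E = E * fps_deriv P"
  shows "E = fps_exp 1 oo P"
proof -
  let ?G = "fps_exp 1 oo P"
  have G0: "fps_nth ?G 0 = 1" by simp
  have odeG: "fps_deriv ?G = ?G * fps_deriv P"
    using P0 by (simp add: fps_compose_deriv)
  have "fps_nth E n = fps_nth ?G n" for n
  proof (induction n rule: less_induct)
    case (less n)
    show ?case
    proof (cases n)
      case 0
      then show ?thesis using E0 G0 by simp
    next
      case (Suc k)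
      have "of_nat (Suc k) * fps_nth E (Suc k) = fps_nth (E * fps_deriv P) k"
        by (simp flip: ode)
      also have "\<dots> = fps_nth (?G * fps_deriv P) k"
        using less Suc by (simp add: fps_mult_nth)
      also have "\<dots> = of_nat (Suc k) * fps_nth ?G (Suc k)"
        by (simp flip: odeG)
      finally show ?thesis using Suc by (simp del: of_nat_Suc)
    qed
  qed
  then show ?thesis by (rule fps_ext)
qed

text \<open>\<open>exp (eval_fps P z)\<close> is holomorphic on the disc of convergence of
  \<open>P\<close>, so its Taylor series converges there; uniqueness of expansions identifies that
  series with the formal composition.\<close>

lemma
  fixes P :: "complex fps"
  assumes P0: "fps_nth P 0 = 0" and R: "0 < fps_conv_radius P"
  shows fps_conv_radius_exp_compose: "fps_conv_radius P \<le> fps_conv_radius (fps_exp 1 oo P)"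
    and eval_fps_exp_compose:
      "norm z < fps_conv_radius P \<Longrightarrow> eval_fps (fps_exp 1 oo P) z = exp (eval_fps P z)"
proof -
  have "(exp \<circ> eval_fps P) has_fps_expansion (fps_exp 1 oo P)"
    using P0 R by (intro has_fps_expansion_compose eval_fps_has_fps_expansion has_fps_expansion_exp1)
  then have eq: "fps_expansion (\<lambda>z. exp (eval_fps P z)) 0 = fps_exp 1 oo P"
    by (intro fps_expansion_eqI) (simp add: o_def)
  have holo: "(\<lambda>z. exp (eval_fps P z)) holomorphic_on eball 0 (fps_conv_radius P)"
    by (intro holomorphic_intros order.refl)
  show "fps_conv_radius P \<le> fps_conv_radius (fps_exp 1 oo P)"
    using conv_radius_fps_expansion[OF holo] by (simp add: eq)
  show "eval_fps (fps_exp 1 oo P) z = exp (eval_fps P z)" if "norm z < fps_conv_radius P"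
    using eval_fps_expansion'[OF holo that] by (simp add: eq)
qed

text \<open>Read coefficientwise, the recurrence is \<open>E' = E * P'\<close>, where
  \<open>P'\<close> has coefficients \<open>a j\<close>; hence \<open>E\<close> is the exponential
  of \<open>P\<close>. The geometric bound puts 1 strictly inside the disc of convergence.\<close>

lemma exp_recurrence:
  fixes a e :: "nat \<Rightarrow> complex"
  assumes e0: "e 0 = 1"
    and rec: "\<And>n. of_nat (Suc n) * e (Suc n) = (\<Sum>j\<le>n. a j * e (n - j))"
    and bound: "\<And>j. norm (a j) \<le> M * q ^ j" and q: "0 < q" "q < 1"
  shows "e sums exp (\<Sum>j. a j / of_nat (Suc j))"
    and "\<exists>w>1. summable (\<lambda>n. norm (e n) * w ^ n)"
proof -
  define P where "P = Abs_fps (\<lambda>n. if n = 0 then 0 else a (n - 1) / of_nat n)"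
  define E where "E = Abs_fps e"
  \<comment> \<open>Any number strictly between 1 and 1/q would serve.\<close>
  define w where "w = inverse (sqrt q)"
  have w: "1 < w" "w * q < 1"
  proof -
    have "sqrt q < 1" "0 < sqrt q" using q by auto
    then show "1 < w" unfolding w_def by (simp add: one_less_inverse)
    have "w * q = sqrt q" unfolding w_def using q by (simp add: field_simps)
    then show "w * q < 1" using \<open>sqrt q < 1\<close> by simp
  qed
  have "summable (\<lambda>n. fps_nth P n * of_real w ^ n)"
  proof (rule summable_norm_cancel, rule summable_comparison_test)
    \<comment> \<open>Coefficient \<open>n\<close> of \<open>P\<close> carries
      \<open>a (n - 1)\<close>; this shift is the source of \<open>M / q\<close> and of starting at
      index 1.\<close>
    show "\<exists>N. \<forall>n\<ge>N. norm (norm (fps_nth P n * of_real w ^ n)) \<le> M / q * (w * q) ^ n"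
    proof (intro exI[of _ 1] allI impI)
      fix n :: nat assume "1 \<le> n"
      then obtain k where n: "n = Suc k" by (cases n) auto
      have "norm (fps_nth P n) \<le> norm (a k)"
        by (simp add: P_def n norm_divide divide_le_eq mult_le_cancel_left1 norm_of_nat
             del: of_nat_Suc)
      also have "\<dots> \<le> M * q ^ k" by (rule bound)
      also have "\<dots> = M / q * q ^ n" using q n by simp
      finally have "norm (fps_nth P n) * w ^ n \<le> M / q * q ^ n * w ^ n"
        using w by (intro mult_right_mono) auto
      then show "norm (norm (fps_nth P n * of_real w ^ n)) \<le> M / q * (w * q) ^ n"
        using w by (simp add: norm_mult norm_power power_mult_distrib mult_ac)
    qed
    show "summable (\<lambda>n. M / q * (w * q) ^ n)"
      using w q by (intro summable_mult summable_geometric) (auto simp: abs_mult)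
  qed
  from conv_radius_geI[OF this] have "ereal w \<le> fps_conv_radius P"
    using w by (simp add: fps_conv_radius_def)
  moreover have "1 < ereal w" using w by simp
  ultimately have R: "1 < fps_conv_radius P" by order
  have R0: "0 < fps_conv_radius P" by (rule less_trans[OF _ R]) simp
  have P0: "fps_nth P 0 = 0" by (simp add: P_def)
  have EP: "E = fps_exp 1 oo P"
  proof (rule fps_exp_compose_eqI[OF P0])
    show "fps_nth E 0 = 1" by (simp add: E_def e0)
    show "fps_deriv E = E * fps_deriv P"
    proof (rule fps_ext)
      fix n
      have "fps_nth (fps_deriv P * E) n = (\<Sum>j\<le>n. a j * e (n - j))"
        by (simp add: fps_mult_nth P_def E_def atLeast0AtMost del: of_nat_Suc)
      then show "fps_nth (fps_deriv E) n = fps_nth (E * fps_deriv P) n"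
        using rec[of n] by (simp add: E_def mult.commute)
    qed
  qed
  have RE: "1 < fps_conv_radius E"
    using R fps_conv_radius_exp_compose[OF P0 R0] EP by simp
  have "(\<lambda>n. fps_nth P n * 1 ^ n) sums eval_fps P 1"
    using R by (intro sums_eval_fps) (simp add: one_ereal_def)
  then have "(\<lambda>j. fps_nth P (Suc j)) sums eval_fps P 1"
    using P0 by (subst sums_Suc_iff) simp
  then have evP: "eval_fps P 1 = (\<Sum>j. a j / of_nat (Suc j))"
    by (simp add: P_def sums_iff del: of_nat_Suc)
  have "(\<lambda>n. fps_nth E n * 1 ^ n) sums eval_fps E 1"
    using RE by (intro sums_eval_fps) (simp add: one_ereal_def)
  moreover have "eval_fps E 1 = exp (eval_fps P 1)"
    using R unfolding EP by (intro eval_fps_exp_compose P0 R0) (simp add: one_ereal_def)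
  ultimately show "e sums exp (\<Sum>j. a j / of_nat (Suc j))"
    by (simp add: E_def evP)
  \<comment> \<open>The room between 1 and the radius of convergence supplies the growing weights
    \<open>r ^ n\<close>.\<close>
  obtain r where r: "ereal 1 < ereal r" "ereal r < fps_conv_radius E"
    using RE ereal_dense2 unfolding one_ereal_def by blast
  have "summable (\<lambda>n. norm (fps_nth E n * of_real r ^ n))"
    using r by (intro norm_summable_fps) auto
  then show "\<exists>w>1. summable (\<lambda>n. norm (e n) * w ^ n)"
    using r by (intro exI[of _ r]) (simp add: E_def norm_mult norm_power)
qed

text \<open>The series of -ln(1 - z) is integrated term by term; the integrals of the absolute
  values are dominated by a geometric series.\<close>

lemma suminf_integral_power_eq_ln:
  fixes h :: "'a \<Rightarrow> complex"
  assumes int: "integrable M h" and bound: "AE t in M. norm (h t) \<le> q" and q: "0 < q" "q < 1"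
  shows "norm (\<integral>t. h t ^ Suc j \<partial>M) \<le> (\<integral>t. norm (h t) \<partial>M) * q ^ j"
    and "(\<Sum>j. (\<integral>t. h t ^ Suc j \<partial>M) / of_nat (Suc j)) = - (\<integral>t. ln (1 - h t) \<partial>M)"
proof -
  have [measurable]: "h \<in> borel_measurable M" using int by auto
  \<comment> \<open>One factor \<open>norm (h t)\<close> is kept for integrability, since the
    measure may be infinite; only the other \<open>j\<close> factors are replaced by
    \<open>q\<close>.\<close>
  have le: "AE t in M. norm (h t ^ Suc j) \<le> norm (h t) * q ^ j" for j
    using bound
  proof eventually_elim
    case (elim t)
    then have "norm (h t) ^ j \<le> q ^ j" by (intro power_mono) auto
    then show ?case by (simp add: norm_mult norm_power mult_left_mono)
  qed
  have intj: "integrable M (\<lambda>t. h t ^ Suc j)" for j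
  proof (rule Bochner_Integration.integrable_bound)
    show "integrable M (\<lambda>t. norm (h t) * q ^ j)" using int by simp
    show "AE t in M. norm (h t ^ Suc j) \<le> norm (norm (h t) * q ^ j)"
      using le[of j] by eventually_elim (use q in \<open>simp add: abs_mult\<close>)
  qed measurable
  have normj: "(\<integral>t. norm (h t ^ Suc j) \<partial>M) \<le> (\<integral>t. norm (h t) \<partial>M) * q ^ j" for j
  proof -
    have "(\<integral>t. norm (h t ^ Suc j) \<partial>M) \<le> (\<integral>t. norm (h t) * q ^ j \<partial>M)"
      using intj int le by (intro integral_mono_AE) auto
    then show ?thesis by simp
  qed
  show "norm (\<integral>t. h t ^ Suc j \<partial>M) \<le> (\<integral>t. norm (h t) \<partial>M) * q ^ j"
    using integral_norm_bound[of M "\<lambda>t. h t ^ Suc j"] normj[of j] by linarith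
  have ser: "AE t in M. summable (\<lambda>j. norm (h t ^ Suc j / of_nat (Suc j)))
      \<and> (\<Sum>j. h t ^ Suc j / of_nat (Suc j)) = - ln (1 - h t)"
    using bound
  proof eventually_elim
    case (elim t)
    then have h1: "norm (h t) < 1" using q by simp
    then have "(\<lambda>n. - ((h t) ^ n) / of_nat n) sums ln (1 - h t)"
      using Ln_series'[of "- h t"] by simp
    then have "(\<lambda>n. h t ^ n / of_nat n) sums - ln (1 - h t)"
      using sums_minus by fastforce
    \<comment> \<open>The term at index 0 is a division by zero, hence 0, so the shift loses
      nothing.\<close>
    then have "(\<lambda>j. h t ^ Suc j / of_nat (Suc j)) sums - ln (1 - h t)"
      by (subst sums_Suc_iff) simp
    moreover have "summable (\<lambda>j. norm (h t ^ Suc j / of_nat (Suc j)))"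
    proof (rule summable_comparison_test')
      show "summable (\<lambda>j. norm (h t) ^ j)" using h1 by (simp add: summable_geometric)
      fix j
      have "norm (h t) ^ Suc j / real (Suc j) \<le> norm (h t) ^ j / 1"
        using h1 by (intro frac_le power_decreasing) auto
      then show "norm (norm (h t ^ Suc j / of_nat (Suc j))) \<le> norm (h t) ^ j"
        by (simp add: norm_divide norm_power norm_mult norm_of_nat del: of_nat_Suc)
    qed
    ultimately show ?case by (auto simp: sums_iff)
  qed
  have "(\<Sum>j. \<integral>t. h t ^ Suc j / of_nat (Suc j) \<partial>M) = (\<integral>t. (\<Sum>j. h t ^ Suc j / of_nat (Suc j)) \<partial>M)"
  proof (rule integral_suminf[symmetric])
    show "integrable M (\<lambda>t. h t ^ Suc j / of_nat (Suc j))" for j using intj by auto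
    show "AE t in M. summable (\<lambda>j. norm (h t ^ Suc j / of_nat (Suc j)))"
      using ser by eventually_elim simp
    show "summable (\<lambda>j. \<integral>t. norm (h t ^ Suc j / of_nat (Suc j)) \<partial>M)"
    proof (rule summable_comparison_test')
      show "summable (\<lambda>j. (\<integral>t. norm (h t) \<partial>M) * q ^ j)"
        using q by (intro summable_mult summable_geometric) auto
      fix j
      have "(\<integral>t. norm (h t ^ Suc j / of_nat (Suc j)) \<partial>M) = (\<integral>t. norm (h t ^ Suc j) \<partial>M) / real (Suc j)"
        by (simp add: norm_divide norm_of_nat del: of_nat_Suc power_Suc)
      also have "\<dots> \<le> (\<integral>t. norm (h t ^ Suc j) \<partial>M) / 1"
        by (intro divide_left_mono) auto
      also have "\<dots> \<le> (\<integral>t. norm (h t) \<partial>M) * q ^ j" using normj[of j] by simp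
      finally show "norm (\<integral>t. norm (h t ^ Suc j / of_nat (Suc j)) \<partial>M) \<le> (\<integral>t. norm (h t) \<partial>M) * q ^ j"
        by simp
    qed
  qed
  also have "\<dots> = (\<integral>t. - ln (1 - h t) \<partial>M)"
    using ser by (intro integral_cong_AE) auto
  finally show "(\<Sum>j. (\<integral>t. h t ^ Suc j \<partial>M) / of_nat (Suc j)) = - (\<integral>t. ln (1 - h t) \<partial>M)"
    by (simp del: of_nat_Suc power_Suc)
qed


section \<open>The Fock representation\<close>

lemma swn_class_cong: "swn_eq c s t \<Longrightarrow> swn_class c s = swn_class c t"
  unfolding swn_class_def swn_rel_def by (auto intro: swn_eq.sym swn_eq.trans)

lemma swn_class_in_algebra: "swn_class c s \<in> swn_algebra c"
  unfolding swn_class_def swn_algebra_def by (rule quotientI) simp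

context fock_representation
begin

section \<open>The algebra relations as operator identities on \<open>H\<close>\<close>

definition annih :: "'d L2Linf \<Rightarrow> 'k \<Rightarrow> 'k" where "annih f = \<pi> (swn_class c (SymB f))"
definition creat :: "'d L2Linf \<Rightarrow> 'k \<Rightarrow> 'k" where "creat f = \<pi> (swn_class c ((SymB f)\<^sup>\<star>))"
definition numop :: "'d L2Linf \<Rightarrow> 'k \<Rightarrow> 'k" where "numop f = \<pi> (swn_class c (SymN f))"

lemma creat_in: "x \<in> H \<Longrightarrow> creat f x \<in> H"
  by (simp add: creat_def maps_to swn_class_in_algebra)

lemma creat_add: "x \<in> H \<Longrightarrow> y \<in> H \<Longrightarrow> creat f (x + y) = creat f x + creat f y"
  and creat_scaleC: "x \<in> H \<Longrightarrow> creat f (z *\<^sub>C x) = z *\<^sub>C creat f x"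
  by (simp_all add: creat_def op_add op_scale swn_class_in_algebra)

lemma scaleC_in: "x \<in> H \<Longrightarrow> z *\<^sub>C x \<in> H"
  using subspace unfolding csubspace_def by auto

lemma cinner_creat_left: "x \<in> H \<Longrightarrow> y \<in> H \<Longrightarrow> cinner (creat f x) y = cinner x (annih f y)"
  by (simp add: creat_def annih_def rep_star)

lemma cinner_creat_right: "x \<in> H \<Longrightarrow> y \<in> H \<Longrightarrow> cinner x (creat f y) = cinner (annih f x) y"
  by (metis cinner_commute cinner_creat_left)

text \<open>\<open>Zero\<close> is congruent to \<open>One\<close> minus \<open>One\<close>, and
  both are represented linearly.\<close>

lemma rep_zero: "x \<in> H \<Longrightarrow> \<pi> (swn_class c Zero) x = 0"
  using rep_add[of x One "(-1) \<cdot>\<^sub>C One"] rep_scale[of x "-1" One] scaleC_of_real[of "-1" x]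
    swn_class_cong[OF swn_eq.add_neg[of c "One :: 'd swn_term"], symmetric] by (simp add: rep_one)

text \<open>Solved for the product with \<open>s\<close> on the left, this form moves
  \<open>s\<close> past \<open>t\<close> towards the vacuum.\<close>

lemma rep_commutator:
  assumes "swn_eq c (commutator s t) r" "x \<in> H"
  shows "\<pi> (swn_class c s) (\<pi> (swn_class c t) x)
    = \<pi> (swn_class c t) (\<pi> (swn_class c s) x) + \<pi> (swn_class c r) x"
proof -
  have "\<pi> (swn_class c r) x = \<pi> (swn_class c (commutator s t)) x"
    by (simp add: swn_class_cong[OF assms(1)])
  also have "\<dots> = \<pi> (swn_class c s) (\<pi> (swn_class c t) x) - \<pi> (swn_class c t) (\<pi> (swn_class c s) x)"
    using assms(2) scaleC_of_real[of "-1" "\<pi> (swn_class c t) (\<pi> (swn_class c s) x)"]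
    by (simp add: commutator_def rep_add rep_scale rep_mult)
  finally show ?thesis by simp
qed

lemma creat_commute: "x \<in> H \<Longrightarrow> creat f (creat g x) = creat g (creat f x)"
  using rep_commutator[OF swn_eq.comm_Bstar_Bstar] by (simp add: creat_def rep_zero)

lemma numop_creat:
  "x \<in> H \<Longrightarrow> numop f (creat g x) = creat g (numop f x) + 2 *\<^sub>C creat (mult_fun f g) x"
  using rep_commutator[OF swn_eq.comm_N_Bstar] by (simp add: creat_def numop_def rep_scale)

lemma annih_creat:
  "x \<in> H \<Longrightarrow> annih f (creat g x) = creat g (annih f x)
    + ((2 * complex_of_real c * L2_inner f g) *\<^sub>C x + 4 *\<^sub>C numop (mult_fun (conj_fun f) g) x)"
  using rep_commutator[OF swn_eq.comm_B_Bstar]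
  by (simp add: creat_def annih_def numop_def rep_scale rep_add rep_one)

lemma annih_vacuum: "annih f \<Phi> = 0" and numop_vacuum: "numop f \<Phi> = 0"
  by (simp_all add: annih_def numop_def B_vacuum N_vacuum)

section \<open>Action of the operators on creation powers of the vacuum\<close>

definition pow :: "'d L2Linf \<Rightarrow> nat \<Rightarrow> 'k" where "pow g n = (creat g ^^ n) \<Phi>"

lemma pow_0: "pow g 0 = \<Phi>" and pow_Suc: "pow g (Suc n) = creat g (pow g n)"
  by (simp_all add: pow_def)

lemma pow_in: "pow g n \<in> H"
  by (induction n) (simp_all add: pow_0 pow_Suc vacuum_in creat_in)

lemma creat_zero: "creat g 0 = 0"
  using creat_scaleC[of \<Phi> g 0] vacuum_in by (simp add: scaleC_zero_left)

text \<open>Passing each of the \<open>n\<close> creators replaces it by twice the creator of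
  \<open>mult_fun h g\<close>; creators commute and the vacuum is killed, so \<open>n\<close> equal
  terms remain.\<close>

lemma numop_pow: "numop h (pow g n) = (2 * of_nat n) *\<^sub>C creat (mult_fun h g) (pow g (n - 1))"
proof (induction n)
  case 0
  then show ?case by (simp add: pow_0 numop_vacuum scaleC_zero_left)
next
  case (Suc n)
  let ?x = "creat (mult_fun h g) (pow g n)"
  have "creat g (numop h (pow g n)) = (2 * of_nat n) *\<^sub>C ?x"
  proof (cases n)
    case 0
    then show ?thesis by (simp add: pow_0 numop_vacuum scaleC_zero_left creat_zero)
  next
    case (Suc k)
    then show ?thesis
      using Suc.IH by (simp add: creat_scaleC creat_in pow_in pow_Suc creat_commute)
  qed
  then have "numop h (pow g (Suc n)) = (2 * of_nat n) *\<^sub>C ?x + 2 *\<^sub>C ?x"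
    by (simp add: pow_Suc numop_creat pow_in)
  then show ?case
    by (simp add: algebra_simps flip: scaleC_add_left)
qed

text \<open>Passing each creator yields one scalar term, and a number operator that then meets k =
  0, ..., n-1 remaining creators. By \<open>numop_pow\<close> these contribute 8k each, in total
  4n(n-1).\<close>

lemma annih_pow:
  "annih u (pow g n) = (2 * complex_of_real c * L2_inner u g * of_nat n) *\<^sub>C pow g (n - 1)
    + (4 * of_nat n * of_nat (n - 1)) *\<^sub>C
        creat (mult_fun (mult_fun (conj_fun u) g) g) (pow g (n - 2))"
proof (induction n)
  case 0
  then show ?case by (simp add: pow_0 annih_vacuum scaleC_zero_left)
next
  case (Suc n)
  let ?k = "2 * complex_of_real c * L2_inner u g"
  let ?v = "mult_fun (mult_fun (conj_fun u) g) g"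
  let ?x = "creat ?v (pow g (n - 1))"
  have "creat g (annih u (pow g n)) = (?k * of_nat n) *\<^sub>C pow g n
      + (4 * of_nat n * of_nat (n - 1)) *\<^sub>C ?x"
  proof -
    \<comment> \<open>Restoring a lowered power by one creator needs untruncated subtraction; where
      it truncates, the coefficient is 0.\<close>
    consider "n = 0" | "n = Suc 0" | k where "n = Suc (Suc k)"
      by (metis not0_implies_Suc)
    then show ?thesis
    proof cases
      case 1
      then show ?thesis by (simp add: pow_0 annih_vacuum scaleC_zero_left creat_zero)
    next
      case 2
      then show ?thesis
        using Suc.IH by (simp add: scaleC_zero_left creat_scaleC pow_in pow_Suc)
    next
      case 3
      then show ?thesis
        using Suc.IH
        by (simp add: creat_scaleC creat_add scaleC_in creat_in pow_in pow_Suc creat_commute)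
    qed
  qed
  then have "annih u (pow g (Suc n)) = ((?k * of_nat n) *\<^sub>C pow g n + ?k *\<^sub>C pow g n)
      + ((4 * of_nat n * of_nat (n - 1)) *\<^sub>C ?x + (4 * (2 * of_nat n)) *\<^sub>C ?x)"
    by (simp add: pow_Suc[of g n] annih_creat pow_in numop_pow scaleC_scaleC)
  also have "\<dots> = (?k * of_nat (Suc n)) *\<^sub>C pow g n + (4 * of_nat (Suc n) * of_nat n) *\<^sub>C ?x"
  proof -
    have "4 * of_nat n * of_nat (n - 1) + 4 * (2 * of_nat n) = (4 * of_nat (Suc n) * of_nat n :: complex)"
      by (cases n) (simp_all add: algebra_simps)
    moreover have "?k * of_nat n + ?k = ?k * of_nat (Suc n)"
      by (simp add: algebra_simps)
    ultimately show ?thesis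
      by (simp only: scaleC_add_left[symmetric])
  qed
  finally show ?case by simp
qed

section \<open>The Gram matrix and its recurrence\<close>

definition gram :: "'d L2Linf \<Rightarrow> 'd L2Linf \<Rightarrow> nat \<Rightarrow> nat \<Rightarrow> complex" where
  "gram f g m n = cinner (pow f m) (pow g n) / (fact m * fact n)"

text \<open>The extra creator is left out of the factorials, so that \<open>annih_pow\<close> acts
  on these quantities with its factors n and n(n-1) cancelled.\<close>

definition gram_right :: "'d L2Linf \<Rightarrow> 'd L2Linf \<Rightarrow> 'd L2Linf \<Rightarrow> nat \<Rightarrow> nat \<Rightarrow> complex" where
  "gram_right f g u m n = cinner (pow f m) (creat u (pow g n)) / (fact m * fact n)"

definition gram_left :: "'d L2Linf \<Rightarrow> 'd L2Linf \<Rightarrow> 'd L2Linf \<Rightarrow> nat \<Rightarrow> nat \<Rightarrow> complex" where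
  "gram_left f g v m n = cinner (creat v (pow f m)) (pow g n) / (fact m * fact n)"

text \<open>The extra creator passes to the other side as an annihilator, where
  \<open>annih_pow\<close> applies. Its second term carries a creator on the right, hence
  \<open>gram_right\<close>.\<close>

lemma gram_left_0: "gram_left f g v m 0 = 0"
  and gram_left_1: "gram_left f g v m (Suc 0) = 2 * complex_of_real c * L2_inner v g * gram f g m 0"
  and gram_left_Suc_Suc: "gram_left f g v m (Suc (Suc n)) =
    2 * complex_of_real c * L2_inner v g * gram f g m (Suc n)
    + 4 * gram_right f g (mult_fun (mult_fun (conj_fun v) g) g) m n"
  by (simp_all add: gram_left_def gram_def gram_right_def cinner_creat_left pow_in annih_pow
      cinner_add_right cinner_scaleC_right scaleC_zero_left cinner_zero_right divide_simps del: of_nat_Suc)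
     (simp add: algebra_simps del: of_nat_Suc)

lemma gram_right_0: "gram_right f g u 0 n = 0"
  and gram_right_1: "gram_right f g u (Suc 0) n = 2 * complex_of_real c * L2_inner f u * gram f g 0 n"
  and gram_right_Suc_Suc: "gram_right f g u (Suc (Suc m)) n =
    2 * complex_of_real c * L2_inner f u * gram f g (Suc m) n
    + 4 * gram_left f g (mult_fun (mult_fun (conj_fun u) f) f) m n"
  by (simp_all add: gram_left_def gram_def gram_right_def cinner_creat_right pow_in annih_pow
      cinner_add_left cinner_scaleC_left scaleC_zero_left cinner_zero_left L2_inner_commute[of f u]
      divide_simps del: of_nat_Suc)
     (simp add: algebra_simps del: of_nat_Suc)

text \<open>Alternating the two expansions splits off one Gram entry at a time; each turn adds a
  factor 4 and a factor \<open>cnj f * g\<close> under the integral. The descent ends when either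
  index is exhausted, hence the \<open>min\<close>.\<close>

lemma gram_right_eq_sum:
  "gram_right f g u m n = (\<Sum>j<min m (Suc n). 2 * complex_of_real c * 4 ^ j
     * (LINT t|lebesgue. cnj (fun_of f t) * fun_of u t * (cnj (fun_of f t) * fun_of g t) ^ j)
     * gram f g (m - 1 - j) (n - j))"
proof (induction m arbitrary: n u rule: induct_nat_012)
  case 0
  then show ?case by (simp add: gram_right_0)
next
  case 1
  then show ?case by (simp add: gram_right_1 L2_inner_def)
next
  case (ge2 m)
  \<comment> \<open>\<open>?v\<close> arises after the expansion on one side and \<open>?w\<close>
    after both; \<open>?w\<close> is \<open>u\<close> times the square of \<open>cnj f * g\<close>,
    so the induction proceeds in steps of two.\<close>
  let ?v = "mult_fun (mult_fun (conj_fun u) f) f"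
  let ?w = "mult_fun (mult_fun (conj_fun ?v) g) g"
  let ?\<nu> = "\<lambda>u j. LINT t|lebesgue. cnj (fun_of f t) * fun_of u t * (cnj (fun_of f t) * fun_of g t) ^ j"
  have \<nu>0: "L2_inner f u = ?\<nu> u 0" by (simp add: L2_inner_def)
  have \<nu>1: "L2_inner ?v g = ?\<nu> u (Suc 0)"
    by (simp add: L2_inner_def mult_fun.rep_eq conj_fun.rep_eq mult_ac)
  have \<nu>2: "?\<nu> ?w j = ?\<nu> u (Suc (Suc j))" for j
    by (simp add: mult_fun.rep_eq conj_fun.rep_eq mult_ac)
  consider "n = 0" | "n = Suc 0" | l where "n = Suc (Suc l)"
    by (metis not0_implies_Suc)
  then show ?case
  proof cases
    case 1
    then show ?thesis by (simp add: gram_right_Suc_Suc gram_left_0 \<nu>0)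
  next
    case 2
    then show ?thesis
      by (simp add: gram_right_Suc_Suc gram_left_1 \<nu>0 \<nu>1 algebra_simps del: power_Suc)
  next
    case 3
    have "min (Suc (Suc m)) (Suc n) = Suc (Suc (min m (Suc l)))" using 3 by simp
    then show ?thesis
      unfolding 3
      by (simp only: gram_right_Suc_Suc gram_left_Suc_Suc \<nu>0 \<nu>1 ge2.IH(1) \<nu>2 sum.lessThan_Suc_shift)
        (simp add: algebra_simps sum_distrib_left)
  qed
qed

text \<open>For \<open>u = g\<close> the extra creator merely extends the power, and the change of
  factorial gives the factor \<open>Suc n\<close>.\<close>

lemma gram_Suc:
  "of_nat (Suc n) * gram f g m (Suc n) = (\<Sum>j<min m (Suc n). 2 * complex_of_real c * 4 ^ j
     * (LINT t|lebesgue. (cnj (fun_of f t) * fun_of g t) ^ Suc j) * gram f g (m - 1 - j) (n - j))"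
proof -
  have "of_nat (Suc n) * gram f g m (Suc n) = gram_right f g g m n"
    by (simp add: gram_def gram_right_def pow_Suc divide_simps del: of_nat_Suc)
  then show ?thesis by (simp add: gram_right_eq_sum)
qed

lemma gram_0_0: "gram f g 0 0 = 1"
  by (simp add: gram_def pow_0 cinner_self_eq_norm vacuum_unit)

text \<open>In \<open>gram_Suc\<close> both indices drop by the same amount j+1, so their difference
  is preserved; for \<open>n = 0\<close> a creator moved across annihilates the vacuum.\<close>

lemma gram_off_diagonal: "m \<noteq> n \<Longrightarrow> gram f g m n = 0"
proof (induction m arbitrary: n rule: less_induct)
  case (less m)
  show ?case
  proof (cases n)
    case 0
    then obtain k where "m = Suc k" using less.prems by (cases m) auto
    then show ?thesis
      using 0 by (simp add: gram_def pow_0 pow_Suc cinner_creat_left pow_in vacuum_in annih_vacuum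
          cinner_zero_right)
  next
    case (Suc k)
    have "of_nat (Suc k) * gram f g m (Suc k) = 0"
      unfolding gram_Suc using less Suc by (intro sum.neutral) auto
    then show ?thesis using Suc by (simp del: of_nat_Suc)
  qed
qed

section \<open>Passage from the Gram matrix to exponential vectors\<close>

lemma cinner_exp_vector_term:
  "cinner (exp_vector_term c \<pi> \<Phi> f m) (exp_vector_term c \<pi> \<Phi> g n) = gram f g m n"
  by (simp add: exp_vector_term_def gram_def pow_def creat_def cinner_scaleR_left
      cinner_scaleR_right divide_simps)

lemma gram_diagonal_sums:
  assumes "Linf_norm f < ereal (1/2)" "Linf_norm g < ereal (1/2)"
  shows "(\<lambda>n. gram f g n n) sums exp (- (complex_of_real c / 2) *
        (LINT t|lebesgue. ln (1 - 4 * cnj (fun_of f t) * fun_of g t)))"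
    and "\<exists>w>1. summable (\<lambda>n. norm (gram f g n n) * w ^ n)"
proof -
  obtain a where a: "0 < a" "a < 1/2" "AE t in lebesgue. norm (fun_of f t) \<le> a"
    using Linf_norm_less_imp_AE_bound[OF assms(1)] by auto
  obtain b where b: "0 < b" "b < 1/2" "AE t in lebesgue. norm (fun_of g t) \<le> b"
    using Linf_norm_less_imp_AE_bound[OF assms(2)] by auto
  define h where "h t = 4 * (cnj (fun_of f t) * fun_of g t)" for t
  \<comment> \<open>The threshold 1/2 enters here: \<open>a * b < 1/4\<close> makes
    \<open>q < 1\<close>.\<close>
  define q where "q = 4 * (a * b)"
  have "a * b < 1/2 * (1/2)" using a b by (intro mult_strict_mono) auto
  then have q: "0 < q" "q < 1" using a b by (simp_all add: q_def)
  have hint: "integrable lebesgue h"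
    unfolding h_def by (intro integrable_mult_right integrable_cnj_mult_L2Linf)
  have hq: "AE t in lebesgue. norm (h t) \<le> q"
    using a(3) b(3) by eventually_elim (use a(1) in \<open>auto simp: h_def q_def norm_mult intro!: mult_mono\<close>)
  note ser = suminf_integral_power_eq_ln[OF hint hq q]
  define \<alpha> where "\<alpha> j = complex_of_real c / 2 * (LINT t|lebesgue. h t ^ Suc j)" for j
  \<comment> \<open>The constants agree since 2c * 4^j = (c/2) * 4^(j+1), the extra 4 being absorbed
    into \<open>h\<close>.\<close>
  have \<alpha>: "\<alpha> j = 2 * complex_of_real c * 4 ^ j
      * (LINT t|lebesgue. (cnj (fun_of f t) * fun_of g t) ^ Suc j)" for j
    by (simp add: \<alpha>_def h_def power_mult_distrib[of 4] del: power_Suc) (simp)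
  have rec: "of_nat (Suc n) * gram f g (Suc n) (Suc n) = (\<Sum>j\<le>n. \<alpha> j * gram f g (n - j) (n - j))" for n
    by (simp add: gram_Suc \<alpha> lessThan_Suc_atMost del: of_nat_Suc power_Suc)
  have bound: "norm (\<alpha> j) \<le> (\<bar>c\<bar> / 2 * (LINT t|lebesgue. norm (h t))) * q ^ j" for j
    using mult_left_mono[OF ser(1)[of j], of "\<bar>c\<bar> / 2"]
    by (simp add: \<alpha>_def norm_mult norm_divide mult.assoc del: power_Suc)
  note E = exp_recurrence[of "\<lambda>n. gram f g n n" \<alpha>, OF gram_0_0 rec bound q]
  show "\<exists>w>1. summable (\<lambda>n. norm (gram f g n n) * w ^ n)" by (rule E(2))
  \<comment> \<open>Summability is required for pulling the constant c/2 out of the infinite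
    sum.\<close>
  have "summable (\<lambda>j. (LINT t|lebesgue. h t ^ Suc j) / of_nat (Suc j))"
  proof (rule summable_comparison_test')
    show "summable (\<lambda>j. (LINT t|lebesgue. norm (h t)) * q ^ j)"
      using q by (intro summable_mult summable_geometric) auto
    fix j
    have "norm (LINT t|lebesgue. h t ^ Suc j) / real (Suc j) \<le> norm (LINT t|lebesgue. h t ^ Suc j) / 1"
      by (intro divide_left_mono) auto
    then show "norm ((LINT t|lebesgue. h t ^ Suc j) / of_nat (Suc j)) \<le> (LINT t|lebesgue. norm (h t)) * q ^ j"
      using ser(1)[of j] by (simp add: norm_divide norm_of_nat del: of_nat_Suc power_Suc)
  qed
  then have "(\<Sum>j. \<alpha> j / of_nat (Suc j)) = complex_of_real c / 2 *
      (\<Sum>j. (LINT t|lebesgue. h t ^ Suc j) / of_nat (Suc j))"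
    by (subst suminf_mult[symmetric]) (simp_all add: \<alpha>_def del: of_nat_Suc power_Suc)
  also have "\<dots> = - (complex_of_real c / 2) *
      (LINT t|lebesgue. ln (1 - 4 * cnj (fun_of f t) * fun_of g t))"
    by (simp only: ser(2)) (simp add: h_def mult.assoc)
  finally show "(\<lambda>n. gram f g n n) sums exp (- (complex_of_real c / 2) *
        (LINT t|lebesgue. ln (1 - 4 * cnj (fun_of f t) * fun_of g t)))"
    using E(1) by simp
qed

text \<open>The diagonal Gram entries are the squared norms. Weighted by \<open>w ^ n\<close> they
  stay summable, and the arithmetic-geometric mean inequality passes from squares to the
  norms.\<close>

lemma summable_exp_vector_term:
  assumes "Linf_norm f < ereal (1/2)"
  shows "summable (exp_vector_term c \<pi> \<Phi> f)"
proof -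
  obtain w where w: "1 < w" "summable (\<lambda>n. norm (gram f f n n) * w ^ n)"
    using gram_diagonal_sums(2)[OF assms assms] by auto
  show ?thesis
  proof (rule summable_comparison_test')
    show "summable (\<lambda>n. norm (gram f f n n) * w ^ n + (1 / w) ^ n)"
      using w by (intro summable_add summable_geometric) auto
    fix n
    let ?x = "norm (exp_vector_term c \<pi> \<Phi> f n)"
    have "norm (gram f f n n) = ?x\<^sup>2"
      by (simp add: cinner_self_eq_norm norm_power flip: cinner_exp_vector_term)
    moreover have "?x \<le> ?x\<^sup>2 * w ^ n + (1 / w) ^ n"
    proof -
      \<comment> \<open>The inequality is applied to \<open>?x * s\<close> and \<open>1 / s\<close>,
        whose product is \<open>?x\<close>.\<close>
      define s where "s = sqrt (w ^ n)"
      have s: "0 < s" "w ^ n = s\<^sup>2" using w by (auto simp: s_def)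
      then have "2 * (?x * s) * (1 / s) \<le> (?x * s)\<^sup>2 + (1 / s)\<^sup>2"
        by (intro sum_squares_bound)
      then have "2 * ?x \<le> ?x\<^sup>2 * w ^ n + (1 / w) ^ n"
        using s by (simp add: power_mult_distrib power_one_over)
      then show ?thesis using norm_ge_zero[of "exp_vector_term c \<pi> \<Phi> f n"] by linarith
    qed
    ultimately show "?x \<le> norm (gram f f n n) * w ^ n + (1 / w) ^ n" by simp
  qed
qed

lemma cinner_exp_vector:
  assumes "Linf_norm f < ereal (1/2)" "Linf_norm g < ereal (1/2)"
  shows "cinner (exp_vector c \<pi> \<Phi> f) (exp_vector c \<pi> \<Phi> g) =
      exp (- (complex_of_real c / 2) *
        (LINT t|lebesgue. ln (1 - 4 * cnj (fun_of f t) * fun_of g t)))"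
proof -
  have "(\<lambda>n. cinner (exp_vector_term c \<pi> \<Phi> f n) (exp_vector_term c \<pi> \<Phi> g n)) sums
      cinner (exp_vector c \<pi> \<Phi> f) (exp_vector c \<pi> \<Phi> g)"
    unfolding exp_vector_def using assms
    by (intro cinner_sums_orthogonal summable_sums summable_exp_vector_term)
       (auto simp: cinner_exp_vector_term gram_off_diagonal)
  then show ?thesis
    using gram_diagonal_sums(1)[OF assms] sums_unique2 by (auto simp: cinner_exp_vector_term)
qed

end

theorem mainTheorem1:
  fixes c :: real
    and H :: "'k::complex_hilbert set"
    and \<pi> :: "'d::finite swn_term set \<Rightarrow> 'k \<Rightarrow> 'k"
    and \<Phi> :: 'k
  assumes "c > 0"
    and "fock_representation c H \<pi> \<Phi>"
  shows "(\<forall>f. Linf_norm f < ereal (1/2) \<longrightarrow> summable (exp_vector_term c \<pi> \<Phi> f)) \<and>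
    (\<forall>f g. Linf_norm f < ereal (1/2) \<longrightarrow> Linf_norm g < ereal (1/2) \<longrightarrow>
      cinner (exp_vector c \<pi> \<Phi> f) (exp_vector c \<pi> \<Phi> g) =
      exp (- (complex_of_real c / 2) *
        (LINT t|lebesgue. ln (1 - 4 * cnj (fun_of f t) * fun_of g t))))"
  using fock_representation.summable_exp_vector_term[OF assms(2)]
    fock_representation.cinner_exp_vector[OF assms(2)] by blast

end
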